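(* Let $p\in\mathbb{N}$ and $A>0$ be fixed, and let $(q_n)_{n\ge1}$ be a sequence with $0<q_n<1$ satisfying $$st\text{-}\lim_n q_n=1,\qquad st\text{-}\lim_n q_n^n=a\ \text{ for some } a<1,\qquad st\text{-}\lim_n\frac{1}{[n]_{q_n}}=0.$$ Then for every $f\in C_B[0,\infty)$, $$st\text{-}\lim_{n\to\infty}\|\mathcal{L}^{q_n}_{n,p}(f;\cdot)-f\|_\rho=0.$$
   Context: $\mathbb{N}$ denotes the positive integers. For $0<q<1$: $[m]_q=\frac{1-q^m}{1-q}$, $[m]_q!=[1]_q[2]_q\cdots[m]_q$ with $[0]_q!=1$, $\left[\begin{smallmatrix}m\\k\end{smallmatrix}\right]_q=\frac{[m]_q!}{[k]_q!\,[m-k]_q!}$, $(1+x)_q^m=\prod_{j=0}^{m-1}(1+q^jx)$, and the $q$-exponential is $e_q^{-x}=\prod_{j=0}^{\infty}\frac{1}{1+(1-q)q^jx}$ for $x\ge0$. The improper Jackson integral is, for $B>0$, $\int_0^{\infty/B}g(t)\,d_qt=(1-q)\sum_{j\in\mathbb{Z}}g\left(\frac{q^j}{B}\right)\frac{q^j}{B}$. For $n,p\in\mathbb{N}$, $A>0$, $0<q<1$, the $q$-Baskakov-Schurer-Szász operator is $$\mathcal{L}^{q}_{n,p}(f;x)=[n+p]_q\sum_{k=0}^{\infty}b^k_{n,p}(x;q)\int_0^{\infty/(A(1-q))}f(t)\,s^k_{n,p}(t;q)\,d_qt,\qquad x\in[0,\infty),$$ where $$b^k_{n,p}(x;q)=\left[\begin{matrix}n+p+k-1\\k\end{matrix}\right]_q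 q^{k^2}\frac{x^k}{(1+x)_q^{n+p+k}},\qquad s^k_{n,p}(t;q)=e_q^{-[n+p]_qt}\,\frac{([n+p]_qt)^k}{[k]_q!}.$$ $C_B[0,\infty)$ is the space of continuous bounded real functions on $[0,\infty)$; $\rho(x)=1+x^2$ and $\|g\|_\rho=\sup_{x\in[0,\infty)}\frac{|g(x)|}{1+x^2}$. A real sequence $(x_j)_{j\ge1}$ converges statistically to $L$, written $st\text{-}\lim_n x_n=L$, if for every $\epsilon>0$, $\lim_{n\to\infty}\frac1n\,|\{j\le n:|x_j-L|\ge\epsilon\}|=0$. *)

theory Defs
  imports "HOL-Analysis.Analysis"
begin

definition q_num :: "real \<Rightarrow> nat \<Rightarrow> real" where
  "q_num q m = (1 - q ^ m) / (1 - q)"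

definition q_fact :: "real \<Rightarrow> nat \<Rightarrow> real" where
  "q_fact q m = (\<Prod>i=1..m. q_num q i)"

text \<open>The truncated subtraction is harmless: the coefficient is only meant for \<open>k \<le> m\<close>.\<close>

definition q_binom :: "real \<Rightarrow> nat \<Rightarrow> nat \<Rightarrow> real" where
  "q_binom q m k = q_fact q m / (q_fact q k * q_fact q (m - k))"

text \<open>The \<open>q\<close>-shifted power \<open>(1 + x)\<^sub>q\<^sup>m\<close>.\<close>

definition q_pow :: "real \<Rightarrow> real \<Rightarrow> nat \<Rightarrow> real" where
  "q_pow q x m = (\<Prod>j<m. 1 + q ^ j * x)"

text \<open>\<open>q_exp_neg q x\<close> is the \<open>q\<close>-exponential \<open>e\<^sub>q\<close> at \<open>-x\<close>, meant for \<open>x \<ge> 0\<close>.\<close>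

definition q_exp_neg :: "real \<Rightarrow> real \<Rightarrow> real" where
  "q_exp_neg q x = (\<Prod>j. 1 / (1 + (1 - q) * q ^ j * x))"

text \<open>The improper Jackson integral of \<open>g\<close> from \<open>0\<close> to \<open>\<infinity>/B\<close>; the bilateral series is read as
  an unconditional sum.\<close>

definition jackson_integral :: "real \<Rightarrow> real \<Rightarrow> (real \<Rightarrow> real) \<Rightarrow> real" where
  "jackson_integral q B g =
     (1 - q) * (\<Sum>\<^sub>\<infinity>j\<in>(UNIV :: int set). g (q powi j / B) * (q powi j / B))"

definition baskakov_basis :: "nat \<Rightarrow> nat \<Rightarrow> real \<Rightarrow> nat \<Rightarrow> real \<Rightarrow> real" where
  "baskakov_basis n p q k x =
     q_binom q (n + p + k - 1) k * q ^ (k ^ 2) * (x ^ k / q_pow q x (n + p + k))"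

definition szasz_basis :: "nat \<Rightarrow> nat \<Rightarrow> real \<Rightarrow> nat \<Rightarrow> real \<Rightarrow> real" where
  "szasz_basis n p q k t =
     q_exp_neg q (q_num q (n + p) * t) * ((q_num q (n + p) * t) ^ k / q_fact q k)"

text \<open>The \<open>q\<close>-Baskakov-Schurer-Szasz operator with parameter \<open>A > 0\<close>. For bounded \<open>f\<close> all the
  series involved converge absolutely.\<close>

definition BSS_operator ::
    "real \<Rightarrow> nat \<Rightarrow> nat \<Rightarrow> real \<Rightarrow> (real \<Rightarrow> real) \<Rightarrow> real \<Rightarrow> real" where
  "BSS_operator A n p q f x =
     q_num q (n + p) *
     (\<Sum>k. baskakov_basis n p q k x *
           jackson_integral q (A * (1 - q)) (\<lambda>t. f t * szasz_basis n p q k t))"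

text \<open>The weighted norm on \<open>[0, \<infinity>)\<close> with weight \<open>1 + x\<^sup>2\<close>. As a real supremum it is only meaningful
  for functions with \<open>\<bar>g x\<bar> / (1 + x\<^sup>2)\<close> bounded, in particular for bounded ones.\<close>

definition weighted_norm :: "(real \<Rightarrow> real) \<Rightarrow> real" where
  "weighted_norm g = (SUP x\<in>{0..}. \<bar>g x\<bar> / (1 + x\<^sup>2))"

text \<open>Statistical convergence of a sequence indexed from \<open>1\<close>; the value at \<open>0\<close> plays no role.\<close>

definition stat_tendsto :: "(nat \<Rightarrow> real) \<Rightarrow> real \<Rightarrow> bool" where
  "stat_tendsto x L \<longleftrightarrow>
     (\<forall>\<epsilon>>0. (\<lambda>n. real (card {j \<in> {1..n}. \<bar>x j - L\<bar> \<ge> \<epsilon>}) / real n) \<longlonglongrightarrow> 0)"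

end

theory Submission
  imports Defs
begin

text \<open>
  The operator is a positive one, \<open>L(f; x) = \<Sum>\<^sub>k W\<^sub>k(x) \<mu>\<^sub>k(f)\<close>, where the \<open>W\<^sub>k(x)\<close> are
  probability weights in \<open>k\<close> (\<open>baskakov_prob\<close>) and \<open>\<mu>\<^sub>k\<close> is the average against the \<open>k\<close>-th Szasz
  basis function, normalised to mass \<open>1\<close>. The argument is of Korovkin type: since \<open>f\<close> is bounded
  and continuous, \<open>\<bar>f t - f x\<bar> \<le> e + C (t - x)\<^sup>2\<close> for all \<open>t \<ge> 0\<close> and all \<open>x\<close> in a given bounded
  interval, so \<open>\<bar>L(f; x) - f x\<bar> \<le> e + C L((t - x)\<^sup>2; x)\<close>
  (\<open>BSS_operator_quadratic_bound\<close>). For large \<open>x\<close> the crude bound \<open>2 sup \<bar>f\<bar>\<close> is enough, because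
  it is divided by \<open>1 + x\<^sup>2\<close>.

  It remains to compute \<open>L((t - x)\<^sup>2; x)\<close> exactly. The Jackson integrals are \<open>q\<close>-Gamma integrals at
  integer arguments; their values follow from the functional equation of the \<open>q\<close>-exponential by
  summation over the bilateral grid \<open>q\<^sup>j/B\<close>, and depend neither on \<open>B\<close> nor,
  therefore, on \<open>A\<close> (\<open>q_gamma_has_sum\<close>). Hence \<open>\<mu>\<^sub>k\<close> of a power of \<open>t\<close> is a polynomial in
  \<open>z = [k]\<^sub>q / q\<^sup>k\<close>. The weights \<open>W\<^sub>k\<close> form a \<open>q\<close>-negative-binomial distribution: their
  sum is \<open>1\<close> by a telescoping recurrence
  (\<open>baskakov_prob_sums_1\<close>), and their first two moments in \<open>z\<close> follow by absorbing a factor \<open>z\<close>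
  into the weight of the next order (\<open>baskakov_prob_absorb\<close>). The outcome is a quadratic polynomial in
  \<open>x\<close> whose coefficients are continuous in \<open>q\<close> and \<open>w = 1 / [n + p]\<^sub>q\<close> and vanish at
  \<open>q = 1\<close>, \<open>w = 0\<close> (\<open>central_moment\<close>).

  Hence the weighted norm is small as soon as \<open>q\<^sub>n\<close> is close to \<open>1\<close> and \<open>1 / [n]\<^sub>q\<close> (which
  bounds \<open>1 / [n + p]\<^sub>q\<close>) is close to \<open>0\<close>, and the exceptional indices for these two conditions
  have density zero.
\<close>

section \<open>\<open>q\<close>-numbers, the \<open>q\<close>-exponential and Jackson integrals of \<open>q\<close>-Gamma type\<close>

lemma q_num_0 [simp]: "q_num q 0 = 0"
  by (simp add: q_num_def)

lemma q_num_add: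
  assumes "q < 1"
  shows "q_num q (m + k) = q_num q m + q ^ m * q_num q k"
  using assms by (simp add: q_num_def field_simps power_add)

lemma q_num_Suc: "q < 1 \<Longrightarrow> q_num q (Suc m) = 1 + q * q_num q m"
  using q_num_add[of q 1 m] by (simp add: q_num_def)

lemma q_num_nonneg: "0 < q \<Longrightarrow> q < 1 \<Longrightarrow> 0 \<le> q_num q m"
  by (simp add: q_num_def power_le_one)

lemma q_num_pos: "0 < q \<Longrightarrow> q < 1 \<Longrightarrow> 0 < m \<Longrightarrow> 0 < q_num q m"
  by (cases m) (simp_all add: q_num_Suc q_num_nonneg add_pos_nonneg)

lemma q_num_mono:
  assumes "0 < q" "q < 1" "m \<le> k"
  shows "q_num q m \<le> q_num q k"
  using assms by (simp add: q_num_def divide_right_mono power_decreasing)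

lemma q_fact_0 [simp]: "q_fact q 0 = 1"
  by (simp add: q_fact_def)

lemma q_fact_Suc [simp]: "q_fact q (Suc m) = q_fact q m * q_num q (Suc m)"
  by (simp add: q_fact_def)

lemma q_fact_pos: "0 < q \<Longrightarrow> q < 1 \<Longrightarrow> 0 < q_fact q m"
  unfolding q_fact_def by (intro prod_pos) (auto intro: q_num_pos)

lemma choose_two_Suc: "Suc k choose 2 = k + (k choose 2)"
  by (simp add: numeral_2_eq_2)

lemma q_exp_neg_convergent:
  fixes q x :: real
  assumes "0 < q" "q < 1" "0 \<le> x"
  shows "convergent_prod (\<lambda>j. 1 / (1 + (1 - q) * q ^ j * x))"
proof -
  have "summable (\<lambda>j. (1 - q) * q ^ j * x)"
    using assms by (intro summable_mult summable_mult2 summable_geometric) simp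
  then have "convergent_prod (\<lambda>j. 1 + (1 - q) * q ^ j * x)"
    using assms
    by (intro summable_imp_convergent_prod_real)
       (auto simp: abs_mult, smt (verit) mult_nonneg_nonneg zero_le_power)
  from convergent_prod_inverse[OF this] show ?thesis
    by (simp add: divide_inverse)
qed

lemma q_exp_neg_pos:
  assumes "0 < q" "q < 1" "0 \<le> x"
  shows "0 < q_exp_neg q x"
  unfolding q_exp_neg_def using assms
  by (intro less_0_prodinf q_exp_neg_convergent) (auto intro!: divide_pos_pos add_pos_nonneg)

lemma q_exp_neg_split:
  assumes "0 < q" "q < 1" "0 \<le> x"
  shows "q_exp_neg q x = q_exp_neg q (q ^ n * x) * (\<Prod>j<n. 1 / (1 + (1 - q) * q ^ j * x))"
proof -
  have "1 / (1 + (1 - q) * q ^ j * x) \<noteq> 0" for j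
    using assms by (smt (verit) divide_eq_0_iff mult_nonneg_nonneg zero_le_power)
  from prodinf_split_initial_segment[OF q_exp_neg_convergent[OF assms], of n, OF this]
  show ?thesis
    by (simp add: q_exp_neg_def power_add mult_ac)
qed

text \<open>In terms of the \<open>q\<close>-derivative \<open>(g (q x) - g x) / ((q - 1) x)\<close>, this says that the
  \<open>q\<close>-derivative of \<open>q_exp_neg q\<close> at \<open>x\<close> is minus its value at \<open>x\<close>. The Jackson integrals below
  are evaluated by summing this identity over the grid.\<close>

lemma q_exp_neg_shift:
  assumes "0 < q" "q < 1" "0 \<le> x"
  shows "q_exp_neg q (q * x) = q_exp_neg q x * (1 + (1 - q) * x)"
proof -
  have "1 + (1 - q) * x > 0" using assms by (simp add: add_pos_nonneg)
  then show ?thesis using q_exp_neg_split[OF assms, of 1] by simp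
qed

lemma q_exp_neg_le_1:
  assumes "0 < q" "q < 1" "0 \<le> x"
  shows "q_exp_neg q x \<le> 1"
proof -
  have "(\<Prod>j\<le>n. 1 / (1 + (1 - q) * q ^ j * x)) \<le> 1" for n
    using assms by (intro prod_le_1) (auto simp: divide_simps add_pos_nonneg)
  then show ?thesis
    unfolding q_exp_neg_def
    by (intro LIMSEQ_le_const2[OF convergent_prod_LIMSEQ[OF q_exp_neg_convergent[OF assms]]]) auto
qed

lemma q_exp_neg_tendsto_0:
  assumes "0 < q" "q < 1" "0 < x"
  shows "(\<lambda>n. q_exp_neg q (x / q ^ n)) \<longlonglongrightarrow> 0"
proof (rule tendsto_sandwich)
  show "\<forall>\<^sub>F n in sequentially. 0 \<le> q_exp_neg q (x / q ^ n)"
    using assms by (intro always_eventually allI less_imp_le q_exp_neg_pos) auto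
  have "q_exp_neg q (x / q ^ n) \<le> q ^ n * (1 / ((1 - q) * x))" for n
  proof -
    have y: "0 < x / q ^ n" using assms by simp
    then have "q_exp_neg q (x / q ^ n) * (1 + (1 - q) * (x / q ^ n)) \<le> 1"
      using q_exp_neg_shift[of q "x / q ^ n"] q_exp_neg_le_1[of q "q * (x / q ^ n)"] assms by simp
    moreover have "0 < q_exp_neg q (x / q ^ n)"
      using y assms by (intro q_exp_neg_pos) auto
    ultimately have "q_exp_neg q (x / q ^ n) * ((1 - q) * (x / q ^ n)) \<le> 1"
      by (simp add: algebra_simps)
    then show ?thesis using assms by (simp add: field_simps)
  qed
  then show "\<forall>\<^sub>F n in sequentially. q_exp_neg q (x / q ^ n) \<le> q ^ n * (1 / ((1 - q) * x))"
    by simp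
  show "(\<lambda>n. q ^ n * (1 / ((1 - q) * x))) \<longlonglongrightarrow> 0"
    using assms by (intro tendsto_mult_left_zero LIMSEQ_realpow_zero) auto
qed simp

lemma q_exp_neg_tendsto_1:
  assumes "0 < q" "q < 1" "0 \<le> x"
  shows "(\<lambda>n. q_exp_neg q (q ^ n * x)) \<longlonglongrightarrow> 1"
proof -
  define P where "P n = (\<Prod>j<n. 1 / (1 + (1 - q) * q ^ j * x))" for n
  have E: "0 < q_exp_neg q x" using assms by (rule q_exp_neg_pos)
  have "P \<longlonglongrightarrow> q_exp_neg q x"
    using convergent_prod_LIMSEQ[OF q_exp_neg_convergent[OF assms]]
    by (subst filterlim_sequentially_Suc[symmetric])
       (simp add: P_def q_exp_neg_def lessThan_Suc_atMost)
  then have "(\<lambda>n. q_exp_neg q x / P n) \<longlonglongrightarrow> q_exp_neg q x / q_exp_neg q x"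
    using E by (intro tendsto_intros) auto
  moreover have "q_exp_neg q x / P n = q_exp_neg q (q ^ n * x)" for n
  proof -
    have "P n \<noteq> 0"
      using q_exp_neg_split[OF assms, of n] E by (metis P_def less_irrefl mult_zero_right)
    then show ?thesis
      using q_exp_neg_split[OF assms, of n] by (simp add: P_def)
  qed
  ultimately show ?thesis using E by simp
qed

lemma has_sum_telescope_int:
  fixes F :: "int \<Rightarrow> real"
  assumes mono: "\<And>j. F j \<le> F (j + 1)"
    and top: "(\<lambda>n. F (int n)) \<longlonglongrightarrow> U" and bot: "(\<lambda>n. F (- int n)) \<longlonglongrightarrow> L"
  shows "((\<lambda>j. F (j + 1) - F j) has_sum (U - L)) UNIV"
proof -
  let ?d = "\<lambda>j. F (j + 1) - F j"
  have "(\<lambda>n. ?d (int n)) sums (U - F 0)"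
    using telescope_sums[OF top] by (simp add: add.commute)
  then have "((\<lambda>n. ?d (int n)) has_sum (U - F 0)) UNIV"
    using mono by (intro sums_nonneg_imp_has_sum) auto
  then have 1: "(?d has_sum (U - F 0)) (range int)"
    by (subst has_sum_reindex) (auto simp: o_def)
  have "(\<lambda>n. ?d (- int (Suc n))) sums (F 0 - L)"
    using telescope_sums'[OF bot] by simp
  moreover have "0 \<le> ?d (- int (Suc n))" for n
    using mono[of "- int (Suc n)"] by simp
  ultimately have "((\<lambda>n. ?d (- int (Suc n))) has_sum (F 0 - L)) UNIV"
    by (rule sums_nonneg_imp_has_sum)
  then have 2: "(?d has_sum (F 0 - L)) (range (\<lambda>n. - int (Suc n)))"
    by (subst has_sum_reindex) (auto simp: o_def inj_on_def)
  have "x \<in> range int \<union> range (\<lambda>n. - int (Suc n))" for x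
    by (cases x rule: int_cases) auto
  then have "range int \<union> range (\<lambda>n. - int (Suc n)) = UNIV" by blast
  moreover have "range int \<inter> range (\<lambda>n. - int (Suc n)) = {}" by auto
  ultimately show ?thesis using has_sum_Un_disjoint[OF 1 2] by simp
qed

text \<open>The \<open>q\<close>-Gamma integral \<open>\<integral> t\<^sup>k e\<^sub>q\<^sup>-\<^sup>t d\<^sub>qt = [k]\<^sub>q! / q\<^bsup>k(k+1)/2\<^esup>\<close> over the grid
  \<open>u q\<^sup>j\<close>. Write \<open>E\<^sub>j\<close> and \<open>v\<^sub>j = u q\<^sup>j\<close> for the value and the node at \<open>j\<close>. By the functional
  equation, \<open>E\<^sub>j\<^sub>+\<^sub>1 - E\<^sub>j = (1 - q) v\<^sub>j E\<^sub>j\<close>, so for \<open>k = 0\<close> the sum telescopes to \<open>1 - 0\<close>. In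
  the step, the same equation multiplied by \<open>v\<^sub>j\<^bsup>k+1\<^esup>\<close> writes the term of order \<open>k + 1\<close> as a
  difference of two terms of order \<open>k\<close>, one of them shifted; summability passes from \<open>k\<close> to
  \<open>k + 1\<close> in the same way. The value does not depend on the position \<open>u\<close> of the grid.\<close>

lemma q_gamma_has_sum:
  fixes q u :: real
  assumes q: "0 < q" "q < 1" and u: "0 < u"
  defines "v \<equiv> \<lambda>j::int. u * q powi j"
  shows "((\<lambda>j. (1 - q) * (q_exp_neg q (v j) * v j ^ Suc k)) has_sum
            q_fact q k / q ^ (Suc k choose 2)) UNIV"
proof (induction k)
  case 0
  have v: "0 < v j" "v (j + 1) = q * v j" for j
    using q u by (simp_all add: v_def power_int_add)
  have *: "(1 - q) * (q_exp_neg q (v j) * v j ^ Suc 0)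
           = q_exp_neg q (v (j + 1)) - q_exp_neg q (v j)" for j
    using q_exp_neg_shift[OF q, of "v j"] v[of j] by (simp add: algebra_simps)
  have le: "q_exp_neg q (v j) \<le> q_exp_neg q (v (j + 1))" for j
  proof -
    have "0 \<le> (1 - q) * (q_exp_neg q (v j) * v j ^ Suc 0)"
      using q q_exp_neg_pos[OF q, of "v j"] v[of j] by auto
    then show ?thesis unfolding * by simp
  qed
  have "((\<lambda>j. q_exp_neg q (v (j + 1)) - q_exp_neg q (v j)) has_sum (1 - 0)) UNIV"
  proof (rule has_sum_telescope_int[where F = "\<lambda>j. q_exp_neg q (v j)"])
    show "q_exp_neg q (v j) \<le> q_exp_neg q (v (j + 1))" for j by (rule le)
    show "(\<lambda>n. q_exp_neg q (v (int n))) \<longlonglongrightarrow> 1"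
      using q_exp_neg_tendsto_1[OF q, of u] u by (simp add: v_def mult.commute)
    show "(\<lambda>n. q_exp_neg q (v (- int n))) \<longlonglongrightarrow> 0"
      using q_exp_neg_tendsto_0[OF q, of u] u
      by (simp add: v_def power_int_minus divide_inverse)
  qed
  then show ?case unfolding * by (simp add: numeral_2_eq_2)
next
  case (Suc k)
  define S where "S = q_fact q k / q ^ (Suc k choose 2)"
  define g where "g j = (1 - q) * (q_exp_neg q (v j) * v j ^ Suc k)" for j
  have v: "0 < v j" "v (j + 1) = q * v j" for j
    using q u by (simp_all add: v_def power_int_add)
  have g: "(g has_sum S) UNIV" unfolding g_def S_def by (rule Suc)
  have gs: "((\<lambda>j. g (j + 1)) has_sum S) UNIV"
    by (subst has_sum_reindex_bij_betw[where g = "\<lambda>j. j + 1"])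
       (auto intro: g bij_betwI[of _ _ _ "\<lambda>j. j - 1"])
  have *: "(1 - q) * (q_exp_neg q (v j) * v j ^ Suc (Suc k))
          = (1 / (1 - q)) * (g (j + 1) * (1 / q ^ Suc k) - g j)" for j
  proof -
    have "g (j + 1) = q ^ Suc k * (g j * (1 + (1 - q) * v j))"
      using q_exp_neg_shift[OF q, of "v j"] v[of j]
      by (simp add: g_def power_mult_distrib mult_ac)
    then have "g (j + 1) * (1 / q ^ Suc k) - g j = g j * ((1 - q) * v j)"
      using q by (simp add: field_simps)
    then show ?thesis using q by (simp add: g_def)
  qed
  have "((\<lambda>j. (1 / (1 - q)) * (g (j + 1) * (1 / q ^ Suc k) - g j)) has_sum
          (1 / (1 - q)) * (S * (1 / q ^ Suc k) - S)) UNIV"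
    using has_sum_add[OF has_sum_cmult_left[OF gs, of "1 / q ^ Suc k"] has_sum_uminusI[OF g]]
    by (intro has_sum_cmult_right) simp
  also have "(1 / (1 - q)) * (S * (1 / q ^ Suc k) - S)
             = q_fact q (Suc k) / q ^ (Suc (Suc k) choose 2)"
  proof -
    have "(1 / (1 - q)) * (S * (1 / q ^ Suc k) - S) = S * q_num q (Suc k) / q ^ Suc k"
      using q by (simp add: q_num_def field_simps)
    also have "\<dots> = q_fact q (Suc k) / q ^ (Suc (Suc k) choose 2)"
      unfolding S_def choose_two_Suc[of "Suc k"] power_add by simp
    finally show ?thesis .
  qed
  finally show ?case unfolding * .
qed

section \<open>The Baskakov weights and their moments\<close>

lemma q_pow_Suc: "q_pow q x (Suc m) = q_pow q x m * (1 + q ^ m * x)"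
  by (simp add: q_pow_def)

lemma q_pow_pos: "0 < q \<Longrightarrow> 0 \<le> x \<Longrightarrow> 0 < q_pow q x m"
  unfolding q_pow_def by (intro prod_pos) (auto intro: add_pos_nonneg)

lemma q_binom_add: "q_binom q (M + k) k = q_fact q (M + k) / (q_fact q k * q_fact q M)"
  by (simp add: q_binom_def)

lemma q_ratio_Suc:
  assumes "0 < q" "q < 1"
  shows "q_num q (Suc k) / q ^ Suc k = (1 + q_num q k / q ^ k) / q"
proof -
  have "q_num q (Suc k) = q_num q k + q ^ k"
    using q_num_add[of q k 1] assms by (simp add: q_num_def)
  then show ?thesis using assms by (simp add: field_simps)
qed

text \<open>In independent trials where the \<open>j\<close>-th succeeds with probability \<open>q\<^sup>jx / (1 + q\<^sup>jx)\<close>, this is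
  the probability of exactly \<open>k\<close> successes before failure number \<open>M + 1\<close>.\<close>

definition baskakov_prob :: "real \<Rightarrow> real \<Rightarrow> nat \<Rightarrow> nat \<Rightarrow> real" where
  "baskakov_prob q x M k =
     q_binom q (M + k) k * q ^ (k choose 2) * x ^ k / q_pow q x (Suc (M + k))"

text \<open>The weights arise from the operator as follows: the Szasz basis function of index \<open>k\<close> has
  Jackson mass proportional to \<open>q\<^bsup>-k(k+1)/2\<^esup>\<close>, which turns the factor \<open>q\<^bsup>k\<^sup>2\<^esup>\<close> of the
  Baskakov basis into \<open>q\<^bsup>k(k-1)/2\<^esup>\<close>.\<close>

lemma baskakov_basis_eq_prob:
  assumes "0 < q" "0 < n + p"
  shows "baskakov_basis n p q k x / q ^ (Suc k choose 2) = baskakov_prob q x (n + p - 1) k"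
proof -
  have k2: "k\<^sup>2 = (Suc k choose 2) + (k choose 2)"
    by (induction k) (simp_all add: choose_two_Suc power2_eq_square)
  obtain M where M: "n + p = Suc M"
    using assms by (cases "n + p") auto
  show ?thesis
    unfolding baskakov_basis_def baskakov_prob_def M k2 power_add
    using assms by (simp del: q_fact_Suc)
qed

context
  fixes q x :: real
  assumes q: "0 < q" "q < 1" and x: "0 \<le> x"
begin

lemma baskakov_prob_nonneg: "0 \<le> baskakov_prob q x M k"
  unfolding baskakov_prob_def q_binom_def
  using q x q_pow_pos[of q x] q_fact_pos[of q]
  by (intro divide_nonneg_pos mult_nonneg_nonneg zero_le_power) (auto intro: less_imp_le)

lemma baskakov_prob_rec_0:
  "baskakov_prob q x (Suc M) 0 * (1 + q ^ Suc M * x) = baskakov_prob q x M 0"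
proof -
  have "1 + q ^ Suc M * x > 0" using q x by (intro add_pos_nonneg) auto
  then show ?thesis
    using q_fact_pos[OF q, of M] q_fact_pos[OF q, of "Suc M"]
    by (simp add: baskakov_prob_def q_binom_def q_pow_Suc[of _ _ "Suc M"] numeral_2_eq_2
             del: q_fact_Suc power_Suc)
qed

text \<open>The \<open>q\<close>-Pascal rule in the form \<open>[M + k + 2] = [M + 1] + q\<^bsup>M+1\<^esup> [k + 1]\<close>.\<close>

lemma baskakov_prob_rec_Suc:
  "baskakov_prob q x (Suc M) (Suc k) * (1 + q ^ (Suc M + Suc k) * x) =
     baskakov_prob q x M (Suc k) + baskakov_prob q x (Suc M) k * (q ^ (Suc M + k) * x)"
proof -
  define G where "G = q_fact q (Suc (M + k)) * q ^ (Suc k choose 2) * x ^ Suc k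
      / (q_fact q (Suc k) * q_fact q (Suc M) * q_pow q x (Suc (Suc (M + k))))"
  have pos: "q_fact q k > 0" "q_fact q M > 0" "q_num q (Suc k) > 0" "q_num q (Suc M) > 0"
     "q_pow q x (Suc (Suc (M + k))) > 0" "1 + q ^ (Suc (Suc (M + k))) * x > 0"
    using q x by (auto simp: q_fact_pos q_num_pos q_pow_pos intro!: add_pos_nonneg)
  have 1: "baskakov_prob q x (Suc M) (Suc k) * (1 + q ^ (Suc M + Suc k) * x)
        = G * q_num q (Suc (Suc (M + k)))"
    unfolding baskakov_prob_def q_binom_add G_def
    using pos by (simp add: q_pow_Suc[of _ _ "Suc (Suc (M + k))"] mult_ac del: power_Suc)
  have 2: "baskakov_prob q x M (Suc k) = G * q_num q (Suc M)"
    unfolding baskakov_prob_def q_binom_add G_def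
    using pos by (simp del: power_Suc)
  have 3: "baskakov_prob q x (Suc M) k * (q ^ (Suc M + k) * x) = G * (q ^ Suc M * q_num q (Suc k))"
    unfolding baskakov_prob_def q_binom_add G_def choose_two_Suc
    using pos by (simp add: power_add mult_ac)
  show ?thesis
    unfolding 1 2 3 using q_num_add[of q "Suc M" "Suc k"] q by (simp add: distrib_left)
qed

text \<open>The recurrence telescopes in \<open>k\<close>, so passing from \<open>M\<close> to \<open>M + 1\<close> changes the total mass
  only by a boundary term, which vanishes in the limit. For \<open>M = 0\<close> the weights are the successive
  differences of the probabilities that the first \<open>k\<close> trials all succeed.\<close>

lemma baskakov_prob_sums_1: "baskakov_prob q x M sums 1"
proof (induction M)
  case 0
  define R where "R k = q ^ (k choose 2) * x ^ k / q_pow q x k" for k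
  have pos: "q_pow q x k > 0" "1 + q ^ k * x > 0" for k
    using q x by (auto simp: q_pow_pos intro!: add_pos_nonneg)
  have R_Suc: "R (Suc k) = R k * (q ^ k * x / (1 + q ^ k * x))" for k
    by (simp add: R_def q_pow_Suc choose_two_Suc power_add mult_ac)
  have R_nonneg: "0 \<le> R k" for k
    using q x pos(1)[of k] by (simp add: R_def)
  have R_le: "R k \<le> 1" for k
  proof (induction k)
    case (Suc k)
    have "q ^ k * x / (1 + q ^ k * x) \<le> 1" "0 \<le> q ^ k * x / (1 + q ^ k * x)"
      using pos(2)[of k] q x by (auto simp: divide_simps)
    then show ?case unfolding R_Suc using Suc by (intro mult_le_one)
  qed (simp add: R_def q_pow_def numeral_2_eq_2)
  have "R (Suc k) \<le> q ^ k * x" for k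
  proof -
    have "q ^ k * x / (1 + q ^ k * x) \<le> q ^ k * x"
      using frac_le[of "q ^ k * x" "q ^ k * x" 1 "1 + q ^ k * x"] q x by simp
    moreover have "R (Suc k) \<le> 1 * (q ^ k * x / (1 + q ^ k * x))"
      unfolding R_Suc using R_le[of k] pos(2)[of k] q x by (intro mult_right_mono) auto
    ultimately show ?thesis by simp
  qed
  then have "(\<lambda>k. R (Suc k)) \<longlonglongrightarrow> 0"
  proof (intro tendsto_sandwich[of "\<lambda>_. 0" "\<lambda>k. R (Suc k)" sequentially "\<lambda>k. q ^ k * x"]
      always_eventually allI tendsto_const)
    show "(\<lambda>k. q ^ k * x) \<longlonglongrightarrow> 0"
      using q by (intro tendsto_mult_left_zero LIMSEQ_realpow_zero) auto
  qed (simp add: R_nonneg)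
  then have "R \<longlonglongrightarrow> 0" by (rule LIMSEQ_imp_Suc)
  from telescope_sums'[OF this] have "(\<lambda>k. R k - R (Suc k)) sums 1"
    by (simp add: R_def q_pow_def numeral_2_eq_2)
  moreover have "R k - R (Suc k) = baskakov_prob q x 0 k" for k
  proof -
    have "R k - R (Suc k) = R k / (1 + q ^ k * x)"
      unfolding R_Suc using pos(2)[of k] by (simp add: divide_simps) (simp add: algebra_simps)
    then show ?thesis
      using q_fact_pos[OF q, of k] by (simp add: baskakov_prob_def R_def q_binom_def q_pow_Suc)
  qed
  ultimately show ?case by simp
next
  case (Suc M)
  let ?W = "baskakov_prob q x (Suc M)"
  \<comment> \<open>The boundary term: the probability of \<open>k\<close> successes before failure number \<open>M + 2\<close>, weighted by
    \<open>q\<^bsup>M+1+k\<^esup>x\<close>, which exchanges that failure for a success.\<close>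
  define V where "V k = ?W k * (q ^ (Suc M + k) * x)" for k
  have part: "sum ?W {..<Suc K} = sum (baskakov_prob q x M) {..<Suc K} - V K" for K
  proof (induction K)
    case 0
    have "?W 0 + V 0 = baskakov_prob q x M 0"
      using baskakov_prob_rec_0[of M] by (simp only: V_def distrib_left mult_1_right add_0_right)
    then show ?case by simp
  next
    case (Suc K)
    have "?W (Suc K) + V (Suc K) = baskakov_prob q x M (Suc K) + V K"
      using baskakov_prob_rec_Suc[of M K] by (simp only: V_def distrib_left mult_1_right)
    then show ?case
      using Suc.IH unfolding sum.lessThan_Suc[of _ "Suc K"] by linarith
  qed
  have V_nonneg: "0 \<le> V k" for k
    using baskakov_prob_nonneg[of "Suc M" k] q x by (simp add: V_def)
  have "sum ?W {..<K} \<le> 1" for K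
  proof (cases K)
    case K: (Suc K')
    have "sum (baskakov_prob q x M) {..<Suc K'} \<le> suminf (baskakov_prob q x M)"
      by (intro sum_le_suminf sums_summable[OF Suc.IH] baskakov_prob_nonneg) simp
    also have "\<dots> = 1" by (rule sums_unique[OF Suc.IH, symmetric])
    finally show ?thesis using part[of K'] V_nonneg[of K'] unfolding K by linarith
  qed simp
  then have "summable ?W"
    by (intro summableI_nonneg_bounded[of _ 1] baskakov_prob_nonneg)
  then have "?W \<longlonglongrightarrow> 0" by (rule summable_LIMSEQ_zero)
  moreover have "(\<lambda>k. q ^ k * (q ^ Suc M * x)) \<longlonglongrightarrow> 0"
    using q by (intro tendsto_mult_left_zero LIMSEQ_realpow_zero) auto
  ultimately have "(\<lambda>k. ?W k * (q ^ k * (q ^ Suc M * x))) \<longlonglongrightarrow> 0 * 0"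
    by (rule tendsto_mult)
  moreover have "V = (\<lambda>k. ?W k * (q ^ k * (q ^ Suc M * x)))"
    by (simp add: V_def fun_eq_iff power_add mult_ac)
  ultimately have "V \<longlonglongrightarrow> 0" by (simp only: mult_zero_left)
  moreover have "(\<lambda>K. sum (baskakov_prob q x M) {..<Suc K}) \<longlonglongrightarrow> 1"
    using Suc.IH unfolding sums_def by (rule LIMSEQ_Suc)
  ultimately have "(\<lambda>K. sum ?W {..<Suc K}) \<longlonglongrightarrow> 1 - 0"
    unfolding part by (intro tendsto_diff)
  then show ?case
    unfolding sums_def diff_zero by (rule LIMSEQ_imp_Suc)
qed

text \<open>The \<open>q\<close>-analogue of \<open>k \<cdot> P(k)\<close> being a multiple of a weight of the next order: it
  reduces each moment in \<open>[k]\<^sub>q / q\<^sup>k\<close> to a moment of lower degree.\<close>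

lemma baskakov_prob_absorb:
  "baskakov_prob q x M (Suc k) * (q_num q (Suc k) / q ^ Suc k)
   = q_num q (Suc M) * x / q * baskakov_prob q x (Suc M) k"
proof -
  have pos: "q_fact q k > 0" "q_fact q M > 0" "q_num q (Suc k) > 0" "q_num q (Suc M) > 0"
    using q by (auto simp: q_fact_pos q_num_pos)
  then show ?thesis
    using q unfolding baskakov_prob_def q_binom_add choose_two_Suc
    by (simp add: power_add mult_ac)
qed

lemma baskakov_prob_first_moment:
  "(\<lambda>k. baskakov_prob q x M k * (q_num q k / q ^ k)) sums (q_num q (Suc M) * x / q)"
proof -
  have "(\<lambda>k. baskakov_prob q x M (Suc k) * (q_num q (Suc k) / q ^ Suc k))
        sums (q_num q (Suc M) * x / q)"
    using sums_mult[OF baskakov_prob_sums_1[of "Suc M"], of "q_num q (Suc M) * x / q"]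
    unfolding baskakov_prob_absorb by simp
  then show ?thesis
    by (subst (asm) sums_Suc_iff) simp
qed

lemma baskakov_prob_second_moment:
  "(\<lambda>k. baskakov_prob q x M k * (q_num q k / q ^ k)\<^sup>2) sums
     (q_num q (Suc M) * x / q * ((1 + q_num q (Suc (Suc M)) * x / q) / q))"
proof -
  let ?z = "\<lambda>k. q_num q k / q ^ k"
  have "(\<lambda>k. (baskakov_prob q x (Suc M) k + baskakov_prob q x (Suc M) k * ?z k) / q)
        sums ((1 + q_num q (Suc (Suc M)) * x / q) / q)"
    by (intro sums_divide sums_add baskakov_prob_sums_1 baskakov_prob_first_moment)
  then have "(\<lambda>k. baskakov_prob q x (Suc M) k * ?z (Suc k))
        sums ((1 + q_num q (Suc (Suc M)) * x / q) / q)"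
    unfolding q_ratio_Suc[OF q] by (simp add: distrib_left add_divide_distrib)
  from sums_mult[OF this, of "q_num q (Suc M) * x / q"]
  have "(\<lambda>k. baskakov_prob q x M (Suc k) * ?z (Suc k) * ?z (Suc k))
        sums (q_num q (Suc M) * x / q * ((1 + q_num q (Suc (Suc M)) * x / q) / q))"
    unfolding baskakov_prob_absorb by (simp add: mult.assoc)
  then have "(\<lambda>k. baskakov_prob q x M (Suc k) * (?z (Suc k))\<^sup>2)
        sums (q_num q (Suc M) * x / q * ((1 + q_num q (Suc (Suc M)) * x / q) / q))"
    by (simp only: power2_eq_square mult.assoc)
  then show ?thesis
    by (subst (asm) sums_Suc_iff) simp
qed

end

section \<open>The operator on quadratic test functions\<close>

lemma szasz_basis_has_sum:
  fixes A q :: real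
  assumes q: "0 < q" "q < 1" and "0 < A" "0 < n + p"
  defines "c \<equiv> q_num q (n + p)" and "u \<equiv> \<lambda>j::int. q powi j / (A * (1 - q))"
  shows "((\<lambda>j. c * (1 - q) * (u j ^ i * szasz_basis n p q k (u j) * u j)) has_sum
     q_fact q (k + i) / (q_fact q k * c ^ i * q ^ (Suc (k + i) choose 2))) UNIV"
proof -
  have c: "0 < c" using q assms(4) unfolding c_def by (rule q_num_pos)
  define b where "b = c / (A * (1 - q))"
  have "0 < b" using c q \<open>0 < A\<close> by (simp add: b_def)
  note has_sum_cmult_right[OF q_gamma_has_sum[OF q this, of "k + i"], of "1 / (q_fact q k * c ^ i)"]
  also have "(\<lambda>j. 1 / (q_fact q k * c ^ i) *
        ((1 - q) * (q_exp_neg q (b * q powi j) * (b * q powi j) ^ Suc (k + i))))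
      = (\<lambda>j. c * (1 - q) * (u j ^ i * szasz_basis n p q k (u j) * u j))"
  proof
    fix j
    have "b * q powi j = c * u j" by (simp add: b_def u_def)
    then show "1 / (q_fact q k * c ^ i) *
        ((1 - q) * (q_exp_neg q (b * q powi j) * (b * q powi j) ^ Suc (k + i)))
      = c * (1 - q) * (u j ^ i * szasz_basis n p q k (u j) * u j)"
      using c q_fact_pos[OF q, of k]
      by (simp add: szasz_basis_def c_def[symmetric] power_add power_mult_distrib)
  qed
  finally show ?thesis by simp
qed

text \<open>With \<open>z = [k]\<^sub>q / q\<^sup>k\<close>, the normalised \<open>k\<close>-th Szasz weight has moments \<open>1\<close>,
  \<open>(1 + z) / (qc)\<close> and \<open>(1 + z)(1 + q + z) / (q\<^sup>3c\<^sup>2)\<close>, whence the value on a quadratic.\<close>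

lemma szasz_basis_quadratic_has_sum:
  fixes A q :: real and k :: nat
  assumes q: "0 < q" "q < 1" and "0 < A" "0 < n + p"
  defines "c \<equiv> q_num q (n + p)" and "u \<equiv> \<lambda>j::int. q powi j / (A * (1 - q))"
    and "z \<equiv> q_num q k / q ^ k"
  shows "((\<lambda>j. (e + C * (u j - x)\<^sup>2) * (c * (1 - q) * (szasz_basis n p q k (u j) * u j))) has_sum
     (e + C * ((1 + z) * (1 + q + z) / (q ^ 3 * c\<^sup>2) - 2 * x * ((1 + z) / (q * c)) + x\<^sup>2))
       / q ^ (Suc k choose 2)) UNIV"
proof -
  define T where "T = q ^ (Suc k choose 2)"
  note F = q_fact_pos[OF q, of k]
  define w where "w i j = c * (1 - q) * (u j ^ i * szasz_basis n p q k (u j) * u j)" for i j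
  have w: "(w i has_sum q_fact q (k + i) / (q_fact q k * c ^ i * q ^ (Suc (k + i) choose 2))) UNIV" for i
    unfolding w_def c_def u_def by (rule szasz_basis_has_sum) (use assms in auto)
  have z1: "q_num q (Suc k) / q ^ Suc k = (1 + z) / q"
    unfolding z_def by (rule q_ratio_Suc[OF q])
  have z2: "q_num q (Suc (Suc k)) / q ^ Suc (Suc k) = (1 + q + z) / q\<^sup>2"
    unfolding q_ratio_Suc[OF q, of "Suc k"] z1 using q by (simp add: field_simps power2_eq_square)
  have w0: "(w 0 has_sum 1 / T) UNIV"
    using w[of 0] F by (simp add: T_def)
  have w1: "(w 1 has_sum (1 + z) / (q * c) / T) UNIV"
  proof -
    have "q_fact q (k + 1) / (q_fact q k * c ^ 1 * q ^ (Suc (k + 1) choose 2))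
        = (q_num q (Suc k) / q ^ Suc k) / c / T"
      using F unfolding T_def Suc_eq_plus1[symmetric] choose_two_Suc[of "Suc k"] power_add
      by (simp add: mult_ac)
    also have "\<dots> = (1 + z) / (q * c) / T" unfolding z1 by simp
    finally show ?thesis using w[of 1] by simp
  qed
  have w2: "(w 2 has_sum (1 + z) * (1 + q + z) / (q ^ 3 * c\<^sup>2) / T) UNIV"
  proof -
    have "q_fact q (k + 2) / (q_fact q k * c ^ 2 * q ^ (Suc (k + 2) choose 2))
        = (q_num q (Suc k) / q ^ Suc k) * (q_num q (Suc (Suc k)) / q ^ Suc (Suc k)) / c\<^sup>2 / T"
      using F unfolding T_def add_2_eq_Suc' choose_two_Suc[of "Suc (Suc k)"] choose_two_Suc[of "Suc k"]
        power_add
      by (simp add: mult_ac)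
    also have "\<dots> = (1 + z) * (1 + q + z) / (q ^ 3 * c\<^sup>2) / T"
      unfolding z1 z2 by (simp add: power3_eq_cube power2_eq_square mult_ac)
    finally show ?thesis using w[of 2] by simp
  qed
  have "((\<lambda>j. (e + C * x\<^sup>2) * w 0 j + (- 2 * C * x) * w 1 j + C * w 2 j) has_sum
      (e + C * x\<^sup>2) * (1 / T) + (- 2 * C * x) * ((1 + z) / (q * c) / T)
      + C * ((1 + z) * (1 + q + z) / (q ^ 3 * c\<^sup>2) / T)) UNIV"
    by (intro has_sum_add has_sum_cmult_right w0 w1 w2)
  also have "(\<lambda>j. (e + C * x\<^sup>2) * w 0 j + (- 2 * C * x) * w 1 j + C * w 2 j)
      = (\<lambda>j. (e + C * (u j - x)\<^sup>2) * (c * (1 - q) * (szasz_basis n p q k (u j) * u j)))"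
    by (simp add: w_def fun_eq_iff algebra_simps power2_eq_square)
  also have "(e + C * x\<^sup>2) * (1 / T) + (- 2 * C * x) * ((1 + z) / (q * c) / T)
      + C * ((1 + z) * (1 + q + z) / (q ^ 3 * c\<^sup>2) / T)
      = (e + C * ((1 + z) * (1 + q + z) / (q ^ 3 * c\<^sup>2) - 2 * x * ((1 + z) / (q * c)) + x\<^sup>2)) / T"
    by (simp add: add_divide_distrib diff_divide_distrib algebra_simps)
  finally show ?thesis unfolding T_def .
qed

text \<open>The value at \<open>x\<close> of the operator on \<open>t \<mapsto> (t - x)\<^sup>2\<close>, as a polynomial in \<open>x\<close>; the parameter
  \<open>w\<close> stands for \<open>1 / [n + p]\<^sub>q\<close>. All three coefficients vanish at \<open>q = 1\<close>, \<open>w = 0\<close>.\<close>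

definition central_moment :: "real \<Rightarrow> real \<Rightarrow> real \<Rightarrow> real" where
  "central_moment q w x =
     (1 / q ^ 5 + w / q ^ 6 - 2 / q\<^sup>2 + 1) * x\<^sup>2 + w * ((2 + q) / q ^ 4 + 1 / q ^ 5 - 2 / q) * x
     + (1 + q) * w\<^sup>2 / q ^ 3"

lemma baskakov_prob_quadratic_sums:
  fixes q x :: real and M :: nat
  assumes q: "0 < q" "q < 1" and x: "0 \<le> x"
  defines "c \<equiv> q_num q (Suc M)" and "z \<equiv> \<lambda>k. q_num q k / q ^ k"
  shows "(\<lambda>k. baskakov_prob q x M k *
       (e + C * ((1 + z k) * (1 + q + z k) / (q ^ 3 * c\<^sup>2) - 2 * x * ((1 + z k) / (q * c)) + x\<^sup>2)))
     sums (e + C * central_moment q (1 / c) x)"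
proof -
  let ?W = "baskakov_prob q x M"
  have c: "0 < c" unfolding c_def using q by (intro q_num_pos) auto
  define a0 where "a0 = e + C * ((1 + q) / (q ^ 3 * c\<^sup>2) - 2 * x / (q * c) + x\<^sup>2)"
  define a1 where "a1 = C * ((2 + q) / (q ^ 3 * c\<^sup>2) - 2 * x / (q * c))"
  define a2 where "a2 = C / (q ^ 3 * c\<^sup>2)"
  have "(\<lambda>k. a0 * ?W k + a1 * (?W k * z k) + a2 * (?W k * (z k)\<^sup>2)) sums
     (a0 * 1 + a1 * (c * x / q) + a2 * (c * x / q * ((1 + q_num q (Suc (Suc M)) * x / q) / q)))"
    unfolding z_def c_def
    by (intro sums_add sums_mult baskakov_prob_sums_1 baskakov_prob_first_moment
        baskakov_prob_second_moment q x)
  also have "(\<lambda>k. a0 * ?W k + a1 * (?W k * z k) + a2 * (?W k * (z k)\<^sup>2))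
     = (\<lambda>k. ?W k *
       (e + C * ((1 + z k) * (1 + q + z k) / (q ^ 3 * c\<^sup>2) - 2 * x * ((1 + z k) / (q * c)) + x\<^sup>2)))"
    unfolding a0_def a1_def a2_def fun_eq_iff divide_inverse by (intro allI) algebra
  also have "a0 * 1 + a1 * (c * x / q) + a2 * (c * x / q * ((1 + q_num q (Suc (Suc M)) * x / q) / q))
     = e + C * central_moment q (1 / c) x"
  proof -
    have c': "q_num q (Suc (Suc M)) = 1 + q * c" unfolding c_def by (rule q_num_Suc) (rule q)
    have 1: "a1 * (c * x / q) = C * ((1 / c) * (2 + q) / q ^ 4 * x - 2 * x\<^sup>2 / q\<^sup>2)"
      unfolding a1_def using c q
      by (simp add: divide_simps eval_nat_numeral) (simp add: algebra_simps)
    have 2: "a2 * (c * x / q * ((1 + (1 + q * c) * x / q) / q))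
        = C * ((1 / c) * x / q ^ 5 + (1 / c) * x\<^sup>2 / q ^ 6 + x\<^sup>2 / q ^ 5)"
      unfolding a2_def using c q
      by (simp add: divide_simps eval_nat_numeral) (simp add: algebra_simps)
    show ?thesis
      unfolding c' 1 2 unfolding a0_def central_moment_def
      by (simp add: divide_inverse algebra_simps power_inverse)
  qed
  finally show ?thesis .
qed

text \<open>The quantitative step: the operator is an average with total mass \<open>1\<close>, so a quadratic
  majorant of \<open>\<bar>f t - f x\<bar>\<close> is inherited by the operator. As the majorant is summable, this also
  gives the convergence of all the series involved.\<close>

lemma BSS_operator_quadratic_bound:
  fixes A q x e C :: real
  assumes q: "0 < q" "q < 1" and A: "0 < A" and n: "0 < n + p" and x: "0 \<le> x"
    and f: "\<And>t. 0 \<le> t \<Longrightarrow> \<bar>f t - f x\<bar> \<le> e + C * (t - x)\<^sup>2"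
  shows "\<bar>BSS_operator A n p q f x - f x\<bar> \<le> e + C * central_moment q (1 / q_num q (n + p)) x"
proof -
  obtain M where M: "n + p = Suc M" using n by (cases "n + p") auto
  define c where "c = q_num q (n + p)"
  define u where "u j = q powi j / (A * (1 - q))" for j :: int
  define s where "s k j = c * (1 - q) * (szasz_basis n p q k (u j) * u j)" for k j
  define W where "W = baskakov_prob q x M"
  define b where "b k = baskakov_basis n p q k x" for k
  define T where "T k = q ^ (Suc k choose 2)" for k
  define z where "z k = q_num q k / q ^ k" for k
  define g where "g k = e + C * ((1 + z k) * (1 + q + z k) / (q ^ 3 * c\<^sup>2)
      - 2 * x * ((1 + z k) / (q * c)) + x\<^sup>2)" for k
  have c: "0 < c" unfolding c_def using q n by (intro q_num_pos) auto
  have T: "0 < T k" for k using q by (simp add: T_def)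
  have b: "b k / T k = W k" for k
    unfolding b_def T_def W_def using baskakov_basis_eq_prob[OF q(1) n, of k x] M by simp
  have u: "0 < u j" for j using q A by (simp add: u_def)
  have s_nonneg: "0 \<le> s k j" for k j
    using c q u[of j] q_exp_neg_pos[OF q, of "c * u j"] q_fact_pos[OF q, of k]
    by (auto simp: s_def szasz_basis_def c_def[symmetric] intro!: mult_nonneg_nonneg divide_nonneg_pos)
  have W_nonneg: "0 \<le> W k" for k
    unfolding W_def by (rule baskakov_prob_nonneg[OF q x])
  have b_nonneg: "0 \<le> b k" for k
    using W_nonneg[of k] T[of k] unfolding b[symmetric] by (simp add: zero_le_divide_iff)
  have maj: "((\<lambda>j. (e + C * (u j - x)\<^sup>2) * s k j) has_sum (g k / T k)) UNIV" for k
    unfolding g_def T_def s_def u_def c_def z_def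
    by (rule szasz_basis_quadratic_has_sum) (use assms in auto)
  have mass: "(s k has_sum (1 / T k)) UNIV" for k
    using szasz_basis_quadratic_has_sum[OF q A n, of 1 0 x k]
    unfolding T_def s_def u_def c_def by simp
  \<comment> \<open>Subtracting \<open>f x\<close> under the integral is exact because the total mass is \<open>1\<close>; only the
    remainders \<open>D k\<close> have to be estimated.\<close>
  define D where "D k = (\<Sum>\<^sub>\<infinity>j. (f (u j) - f x) * s k j)" for k
  have dom: "norm ((f (u j) - f x) * s k j) \<le> (e + C * (u j - x)\<^sup>2) * s k j" for k j
    using f[of "u j"] u[of j] s_nonneg[of k j] by (simp add: abs_mult mult_right_mono)
  have D: "((\<lambda>j. (f (u j) - f x) * s k j) has_sum D k) UNIV" for k
  proof -
    have "(\<lambda>j. norm ((f (u j) - f x) * s k j)) summable_on UNIV"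
      by (rule Infinite_Sum.abs_summable_on_comparison_test'[OF has_sum_imp_summable[OF maj]]) (rule dom)
    then show ?thesis
      unfolding D_def by (rule has_sum_infsum[OF Infinite_Sum.abs_summable_summable])
  qed
  have D_le: "\<bar>D k\<bar> \<le> g k / T k" for k
    using norm_infsum_le[OF D maj dom] by simp
  have J: "c * jackson_integral q (A * (1 - q)) (\<lambda>t. f t * szasz_basis n p q k t)
           = D k + f x * (1 / T k)" for k
  proof -
    have "((\<lambda>j. (f (u j) - f x) * s k j + f x * s k j) has_sum (D k + f x * (1 / T k))) UNIV"
      by (intro has_sum_add D has_sum_cmult_right mass)
    also have "(\<lambda>j. (f (u j) - f x) * s k j + f x * s k j)
      = (\<lambda>j. (c * (1 - q)) * (f (u j) * szasz_basis n p q k (u j) * u j))"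
      by (simp add: s_def fun_eq_iff algebra_simps)
    finally have "(\<Sum>\<^sub>\<infinity>j. (c * (1 - q)) * (f (u j) * szasz_basis n p q k (u j) * u j))
        = D k + f x * (1 / T k)"
      by (rule infsumI)
    then show ?thesis
      unfolding infsum_cmult_right' jackson_integral_def u_def by simp
  qed
  have g_sums: "(\<lambda>k. W k * g k) sums (e + C * central_moment q (1 / c) x)"
    unfolding W_def g_def z_def c_def M by (rule baskakov_prob_quadratic_sums[OF q x])
  have bD: "norm (b k * D k) \<le> W k * g k" for k
  proof -
    have "norm (b k * D k) \<le> b k * (g k / T k)"
      unfolding real_norm_def abs_mult abs_of_nonneg[OF b_nonneg]
      by (intro mult_left_mono D_le b_nonneg)
    also have "\<dots> = W k * g k" unfolding b[symmetric] by simp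
    finally show ?thesis .
  qed
  then have bD_summable: "summable (\<lambda>k. b k * D k)"
    by (intro summable_comparison_test'[OF sums_summable[OF g_sums], of 0])
  have "\<bar>\<Sum>k. b k * D k\<bar> \<le> e + C * central_moment q (1 / c) x"
    using norm_suminf_le[OF bD sums_summable[OF g_sums]] sums_unique[OF g_sums, symmetric] by simp
  moreover have "BSS_operator A n p q f x = (\<Sum>k. b k * D k) + f x"
  proof -
    have "(\<lambda>k. b k * D k + f x * W k) sums ((\<Sum>k. b k * D k) + f x * 1)"
      unfolding W_def
      by (intro sums_add sums_mult baskakov_prob_sums_1 q x summable_sums bD_summable)
    also have "(\<lambda>k. b k * D k + f x * W k)
      = (\<lambda>k. c * (b k * jackson_integral q (A * (1 - q)) (\<lambda>t. f t * szasz_basis n p q k t)))"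
    proof
      fix k
      have "c * (b k * jackson_integral q (A * (1 - q)) (\<lambda>t. f t * szasz_basis n p q k t))
        = b k * (D k + f x * (1 / T k))"
        unfolding J[symmetric] by simp
      then show "b k * D k + f x * W k
        = c * (b k * jackson_integral q (A * (1 - q)) (\<lambda>t. f t * szasz_basis n p q k t))"
        unfolding b[symmetric] by (simp add: algebra_simps)
    qed
    finally have *: "(\<lambda>k. c * (b k * jackson_integral q (A * (1 - q)) (\<lambda>t. f t * szasz_basis n p q k t)))
        sums ((\<Sum>k. b k * D k) + f x)" by simp
    from sums_mult[OF this, of "1 / c"] c
    have "(\<lambda>k. b k * jackson_integral q (A * (1 - q)) (\<lambda>t. f t * szasz_basis n p q k t))
        sums (((\<Sum>k. b k * D k) + f x) / c)" by simp
    from sums_unique[OF this, symmetric] c show ?thesis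
      by (simp add: BSS_operator_def b_def c_def)
  qed
  ultimately show ?thesis by (simp add: c_def)
qed

section \<open>Uniform smallness of the central moment and statistical convergence\<close>

lemma central_moment_small:
  fixes X \<eta> :: real
  assumes "0 \<le> X" "0 < \<eta>"
  obtains \<delta> where "0 < \<delta>"
    "\<And>q w x. \<bar>q - 1\<bar> < \<delta> \<Longrightarrow> \<bar>w\<bar> < \<delta> \<Longrightarrow> 0 \<le> x \<Longrightarrow> x \<le> X \<Longrightarrow> central_moment q w x \<le> \<eta>"
proof -
  \<comment> \<open>A majorant of the central moment on \<open>[0, X]\<close> that no longer involves \<open>x\<close>.\<close>
  define h where "h = (\<lambda>(q, w). \<bar>1 / q ^ 5 + w / q ^ 6 - 2 / q\<^sup>2 + 1\<bar> * X\<^sup>2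
      + \<bar>w * ((2 + q) / q ^ 4 + 1 / q ^ 5 - 2 / q)\<bar> * X + \<bar>(1 + q) * w\<^sup>2 / q ^ 3\<bar>)"
  have "isCont h (1, 0)"
    unfolding h_def case_prod_beta by (intro continuous_intros) auto
  then obtain d where "0 < d" "\<And>p. dist p (1, 0) < d \<Longrightarrow> dist (h p) (h (1, 0)) < \<eta>"
    using \<open>0 < \<eta>\<close> unfolding continuous_at_eps_delta by blast
  moreover have "h (1, 0) = 0" by (simp add: h_def)
  ultimately have d: "0 < d" "\<And>p. dist p (1, 0) < d \<Longrightarrow> \<bar>h p\<bar> < \<eta>"
    by (simp_all add: dist_real_def)
  show thesis
  proof (rule that[of "d / 2"])
    fix q w x :: real
    assume *: "\<bar>q - 1\<bar> < d / 2" "\<bar>w\<bar> < d / 2" "0 \<le> x" "x \<le> X"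
    have "dist (q, w) (1, 0) \<le> \<bar>q - 1\<bar> + \<bar>w\<bar>"
      using sqrt_sum_squares_le_sum_abs[of "q - 1" w] by (simp add: dist_prod_def dist_real_def)
    then have "h (q, w) < \<eta>" using d(2)[of "(q, w)"] * by simp
    moreover have "central_moment q w x \<le> h (q, w)"
    proof -
      have "a * x\<^sup>2 + b * x + c \<le> \<bar>a\<bar> * X\<^sup>2 + \<bar>b\<bar> * X + \<bar>c\<bar>" for a b c :: real
      proof -
        have "a * x\<^sup>2 \<le> \<bar>a\<bar> * X\<^sup>2" "b * x \<le> \<bar>b\<bar> * X"
          using *(3,4) by (auto intro!: mult_mono power_mono)
        then show ?thesis by linarith
      qed
      then show ?thesis unfolding central_moment_def h_def prod.case .
    qed
    ultimately show "central_moment q w x \<le> \<eta>" by simp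
  qed (use d in simp)
qed

text \<open>A modulus of continuity of Korovkin type, uniform for \<open>x\<close> in a bounded interval while \<open>t\<close>
  ranges over the half line: close to \<open>x\<close> the first term works, away from \<open>x\<close> the second one
  exceeds the oscillation of \<open>f\<close>.\<close>

lemma bounded_continuous_quadratic_modulus:
  fixes f :: "real \<Rightarrow> real"
  assumes cont: "continuous_on {0..} f" and M: "\<And>t. 0 \<le> t \<Longrightarrow> \<bar>f t\<bar> \<le> M" and "0 < e"
  obtains C where "0 \<le> C"
    "\<And>x t. 0 \<le> x \<Longrightarrow> x \<le> X \<Longrightarrow> 0 \<le> t \<Longrightarrow> \<bar>f t - f x\<bar> \<le> e + C * (t - x)\<^sup>2"
proof -
  have "uniformly_continuous_on {0..X + 1} f"
    by (intro compact_uniformly_continuous continuous_on_subset[OF cont]) auto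
  then obtain d where d: "0 < d"
    "\<And>s t. s \<in> {0..X + 1} \<Longrightarrow> t \<in> {0..X + 1} \<Longrightarrow> \<bar>t - s\<bar> < d \<Longrightarrow> \<bar>f t - f s\<bar> < e"
    using \<open>0 < e\<close> unfolding uniformly_continuous_on_def dist_real_def by metis
  \<comment> \<open>With \<open>r \<le> 1\<close>, a point \<open>t\<close> closer than \<open>r\<close> to \<open>x \<le> X\<close> stays in \<open>[0, X + 1]\<close>.\<close>
  define r where "r = min d 1"
  have r: "0 < r" "r \<le> d" "r \<le> 1" using d(1) by (auto simp: r_def)
  have "0 \<le> M" using M[of 0] by simp
  show thesis
  proof (rule that[of "2 * M / r\<^sup>2"])
    fix x t :: real assume xt: "0 \<le> x" "x \<le> X" "0 \<le> t"
    have C: "0 \<le> 2 * M / r\<^sup>2 * (t - x)\<^sup>2" using \<open>0 \<le> M\<close> by simp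
    show "\<bar>f t - f x\<bar> \<le> e + 2 * M / r\<^sup>2 * (t - x)\<^sup>2"
    proof (cases "\<bar>t - x\<bar> < r")
      case True
      then have "\<bar>f t - f x\<bar> < e" using xt r by (intro d(2)) auto
      then show ?thesis using C by simp
    next
      case False
      then have "r\<^sup>2 \<le> (t - x)\<^sup>2" using r(1) by (metis abs_le_square_iff abs_of_pos not_less)
      then have "2 * M * r\<^sup>2 \<le> 2 * M * (t - x)\<^sup>2" using \<open>0 \<le> M\<close> by (intro mult_left_mono) auto
      then have "2 * M \<le> 2 * M / r\<^sup>2 * (t - x)\<^sup>2" using r(1) by (simp add: field_simps)
      moreover have "\<bar>f t - f x\<bar> \<le> 2 * M" using M[of t] M[of x] xt by linarith
      ultimately show ?thesis using \<open>0 < e\<close> by linarith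
    qed
  qed (use \<open>0 \<le> M\<close> in simp)
qed

lemma weighted_norm_bounds:
  assumes "\<And>x. 0 \<le> x \<Longrightarrow> \<bar>g x\<bar> / (1 + x\<^sup>2) \<le> e"
  shows "0 \<le> weighted_norm g" "weighted_norm g \<le> e"
proof -
  have "bdd_above ((\<lambda>x. \<bar>g x\<bar> / (1 + x\<^sup>2)) ` {0..})"
    using assms by (intro bdd_aboveI2[where M = e]) auto
  from cSUP_upper[OF _ this, of 0] have "\<bar>g 0\<bar> \<le> weighted_norm g"
    by (simp add: weighted_norm_def)
  then show "0 \<le> weighted_norm g" by linarith
  show "weighted_norm g \<le> e"
    unfolding weighted_norm_def using assms by (intro cSUP_least) auto
qed

text \<open>Convergence of the operators in terms of the two quantities \<open>q - 1\<close> and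
  \<open>1 / [n + p]\<^sub>q\<close> alone. For \<open>x\<close> beyond \<open>X\<close> the boundedness of \<open>f\<close> suffices because of the
  weight; on \<open>[0, X]\<close> the quadratic modulus reduces everything to the central moment.\<close>

lemma weighted_norm_BSS_operator_small:
  fixes A e :: real and f :: "real \<Rightarrow> real"
  assumes "0 < A" and cont: "continuous_on {0..} f" and bdd: "bounded (f ` {0..})" and e: "0 < e"
  obtains \<delta> where "0 < \<delta>"
    "\<And>n p q. 0 < n + p \<Longrightarrow> 0 < q \<Longrightarrow> q < 1 \<Longrightarrow> \<bar>q - 1\<bar> < \<delta> \<Longrightarrow> 1 / q_num q (n + p) < \<delta> \<Longrightarrow>
       \<bar>weighted_norm (\<lambda>x. BSS_operator A n p q f x - f x)\<bar> < e"
proof -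
  obtain M where M: "\<And>t. 0 \<le> t \<Longrightarrow> \<bar>f t\<bar> \<le> M"
    using bdd unfolding bounded_iff by auto
  have M0: "0 \<le> M" using M[of 0] by simp
  \<comment> \<open>Beyond \<open>X\<close> the crude bound gives \<open>2 M \<le> e X / 2 \<le> e (1 + x\<^sup>2) / 2\<close>, where the last
    step uses \<open>x \<le> x\<^sup>2\<close>; this is why \<open>X \<ge> 1\<close>.\<close>
  define X where "X = max 1 (4 * M / e)"
  have X: "1 \<le> X" "4 * M \<le> e * X"
    using e by (auto simp: X_def max_def field_simps)
  obtain C where C: "0 \<le> C"
    "\<And>x t. 0 \<le> x \<Longrightarrow> x \<le> X \<Longrightarrow> 0 \<le> t \<Longrightarrow> \<bar>f t - f x\<bar> \<le> e / 4 + C * (t - x)\<^sup>2"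
    using bounded_continuous_quadratic_modulus[OF cont M, of "e / 4" X] e by auto
  \<comment> \<open>\<open>C + 1\<close> in the denominator, as \<open>C\<close> may be \<open>0\<close>.\<close>
  obtain \<delta> where \<delta>: "0 < \<delta>"
    "\<And>q w x. \<bar>q - 1\<bar> < \<delta> \<Longrightarrow> \<bar>w\<bar> < \<delta> \<Longrightarrow> 0 \<le> x \<Longrightarrow> x \<le> X
        \<Longrightarrow> central_moment q w x \<le> e / (4 * (C + 1))"
    using central_moment_small[of X "e / (4 * (C + 1))"] X(1) C(1) e by auto
  show thesis
  proof (rule that[OF \<delta>(1)])
    fix n p :: nat and q :: real
    assume n: "0 < n + p" and q: "0 < q" "q < 1" "\<bar>q - 1\<bar> < \<delta>" "1 / q_num q (n + p) < \<delta>"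
    let ?g = "\<lambda>x. BSS_operator A n p q f x - f x"
    note bound = BSS_operator_quadratic_bound[OF q(1,2) \<open>0 < A\<close> n]
    have c: "0 < q_num q (n + p)" using q n by (intro q_num_pos)
    have "\<bar>?g x\<bar> / (1 + x\<^sup>2) \<le> e / 2" if x: "0 \<le> x" for x
    proof (cases "x \<le> X")
      case True
      have "\<bar>?g x\<bar> \<le> e / 4 + C * central_moment q (1 / q_num q (n + p)) x"
        using x True C(2) by (intro bound) auto
      also have "C * central_moment q (1 / q_num q (n + p)) x \<le> C * (e / (4 * (C + 1)))"
        using \<delta>(2)[of q "1 / q_num q (n + p)" x] q c x True C(1) by (intro mult_left_mono) auto
      also have "\<dots> \<le> e / 4" using C(1) e by (simp add: field_simps)
      finally have "\<bar>?g x\<bar> \<le> e / 2" by simp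
      also have "\<dots> \<le> e / 2 * (1 + x\<^sup>2)" using e by (simp add: field_simps)
      finally show ?thesis by (simp add: divide_le_eq add_pos_nonneg)
    next
      case False
      have "\<bar>f t - f x\<bar> \<le> 2 * M + 0 * (t - x)\<^sup>2" if "0 \<le> t" for t
        using M[OF x] M[OF that] by linarith
      from bound[OF x this] have "\<bar>?g x\<bar> \<le> 2 * M" by simp
      also have "\<dots> \<le> e / 2 * X" using X(2) by simp
      also have "X \<le> 1 + x\<^sup>2"
      proof -
        have "1 * x \<le> x * x" using False X(1) by (intro mult_right_mono) auto
        then show ?thesis using False by (simp add: power2_eq_square)
      qed
      finally have "\<bar>?g x\<bar> \<le> e / 2 * (1 + x\<^sup>2)" using e by simp
      then show ?thesis by (simp add: divide_le_eq add_pos_nonneg)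
    qed
    from weighted_norm_bounds[of ?g, OF this] show "\<bar>weighted_norm ?g\<bar> < e"
      using e by linarith
  qed
qed

text \<open>A continuity principle: the indices where the third sequence is far from its limit are
  bad for one of the two others, and a union of two sets of density zero has density zero.\<close>

lemma stat_tendsto_transfer2:
  assumes x: "stat_tendsto x L" and y: "stat_tendsto y M"
    and close: "\<And>\<epsilon>. 0 < \<epsilon> \<Longrightarrow> \<exists>\<delta>>0. \<forall>n\<ge>1. \<bar>x n - L\<bar> < \<delta> \<longrightarrow> \<bar>y n - M\<bar> < \<delta> \<longrightarrow> \<bar>z n - K\<bar> < \<epsilon>"
  shows "stat_tendsto z K"
  unfolding stat_tendsto_def
proof (intro allI impI)
  fix \<epsilon> :: real assume "0 < \<epsilon>"
  from close[OF this] obtain \<delta> where \<delta>: "0 < \<delta>"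
    "\<And>n. 1 \<le> n \<Longrightarrow> \<bar>x n - L\<bar> < \<delta> \<Longrightarrow> \<bar>y n - M\<bar> < \<delta> \<Longrightarrow> \<bar>z n - K\<bar> < \<epsilon>" by auto
  let ?B = "\<lambda>u N r n. {j \<in> {1..n}. r \<le> \<bar>u j - N\<bar>} :: nat set"
  have "card (?B z K \<epsilon> n) \<le> card (?B x L \<delta> n) + card (?B y M \<delta> n)" for n
  proof -
    have "?B z K \<epsilon> n \<subseteq> ?B x L \<delta> n \<union> ?B y M \<delta> n"
      using \<delta>(2) by force
    then have "card (?B z K \<epsilon> n) \<le> card (?B x L \<delta> n \<union> ?B y M \<delta> n)"
      by (intro card_mono) auto
    also have "\<dots> \<le> card (?B x L \<delta> n) + card (?B y M \<delta> n)" by (rule card_Un_le)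
    finally show ?thesis .
  qed
  then have le: "real (card (?B z K \<epsilon> n)) / real n
      \<le> real (card (?B x L \<delta> n)) / real n + real (card (?B y M \<delta> n)) / real n" for n
    unfolding add_divide_distrib[symmetric] of_nat_add[symmetric]
    by (intro divide_right_mono) (auto simp only: of_nat_le_iff of_nat_0_le_iff)
  have sum: "(\<lambda>n. real (card (?B x L \<delta> n)) / real n + real (card (?B y M \<delta> n)) / real n)
      \<longlonglongrightarrow> 0"
    using x y \<delta>(1) unfolding stat_tendsto_def by (intro tendsto_add_zero) auto
  show "(\<lambda>n. real (card (?B z K \<epsilon> n)) / real n) \<longlonglongrightarrow> 0"
    by (rule tendsto_sandwich[OF _ always_eventually[OF allI[OF le]] tendsto_const sum]) simp
qed

theorem theorem15:
  fixes p :: nat and A a :: real and q :: "nat \<Rightarrow> real" and f :: "real \<Rightarrow> real"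
  assumes "p \<ge> 1" and "A > 0"
    and "\<And>n. n \<ge> 1 \<Longrightarrow> 0 < q n \<and> q n < 1"
    and "stat_tendsto q 1"
    and "stat_tendsto (\<lambda>n. q n ^ n) a" and "a < 1"
    and "stat_tendsto (\<lambda>n. 1 / q_num (q n) n) 0"
    and "continuous_on {0..} f" and "bounded (f ` {0..})"
  shows "stat_tendsto (\<lambda>n. weighted_norm (\<lambda>x. BSS_operator A n p (q n) f x - f x)) 0"
proof (rule stat_tendsto_transfer2[OF assms(4,7)])
  fix \<epsilon> :: real assume "0 < \<epsilon>"
  then obtain \<delta> where \<delta>: "0 < \<delta>"
    "\<And>n p q. 0 < n + p \<Longrightarrow> 0 < q \<Longrightarrow> q < 1 \<Longrightarrow> \<bar>q - 1\<bar> < \<delta> \<Longrightarrow> 1 / q_num q (n + p) < \<delta> \<Longrightarrow>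
       \<bar>weighted_norm (\<lambda>x. BSS_operator A n p q f x - f x)\<bar> < \<epsilon>"
    using weighted_norm_BSS_operator_small[OF assms(2,8,9)] by blast
  have "\<bar>weighted_norm (\<lambda>x. BSS_operator A n p (q n) f x - f x)\<bar> < \<epsilon>"
    if n: "1 \<le> n" "\<bar>q n - 1\<bar> < \<delta>" "\<bar>1 / q_num (q n) n\<bar> < \<delta>" for n
  proof (rule \<delta>(2))
    have q: "0 < q n" "q n < 1" using assms(3) n(1) by auto
    have "1 / q_num (q n) (n + p) \<le> 1 / q_num (q n) n"
      using q n(1) q_num_pos[OF q, of n] by (intro divide_left_mono q_num_mono mult_pos_pos)
        (auto intro: q_num_pos)
    then show "1 / q_num (q n) (n + p) < \<delta>" using n(3) by linarith
  qed (use n assms(3) in auto)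
  then show "\<exists>\<delta>>0. \<forall>n\<ge>1. \<bar>q n - 1\<bar> < \<delta> \<longrightarrow> \<bar>1 / q_num (q n) n - 0\<bar> < \<delta> \<longrightarrow>
      \<bar>weighted_norm (\<lambda>x. BSS_operator A n p (q n) f x - f x) - 0\<bar> < \<epsilon>"
    using \<delta>(1) by auto
qed

end
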